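(* Let $k\ge 2$ be an integer and let $T$ be a tree on $n$ vertices, where $n\ge k$. Then $\alpha_k(T)\ge \frac{k-1}{k}\,n$. Moreover, equality $\alpha_k(T)=\frac{k-1}{k}\,n$ holds if and only if $k\mid n$ and $T\in R^k_{n/k}$.
   Context: All graphs are finite and simple. For a graph $G$ with vertex set $V_G$ and an integer $k\ge 2$, a set $S\subseteq V_G$ is a generalized $k$-independent set if the induced subgraph $G[S]$ contains no tree on $k$ vertices as a (not necessarily induced) subgraph. The generalized $k$-independence number $\alpha_k(G)$ is the maximum size of a generalized $k$-independent set of $G$. For integers $k\ge 2$ and $i\ge 1$, the family $R_i^k$ of trees on $ik$ vertices is defined recursively: $R_1^k$ is the set of all trees on $k$ vertices; for $i\ge 2$, a tree $T$ lies in $R_i^k$ if there exist $T'\in R_{i-1}^k$ and a tree $T''$ on $k$ vertices such that $T$ is obtained from the disjoint union $T'\cup T''$ by adding a single edge joining a vertex of $T'$ to a vertex of $T''$. *)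

theory Defs
  imports Complex_Main "Graph_Theory.Graph_Theory"
begin

text \<open>
  A finite simple graph is a \<^verbatim>\<open>pair_graph\<close>: a finite, loop-free digraph without parallel arcs
  whose arc relation is symmetric, so that an edge \<open>uv\<close> is the pair of arcs \<open>(u, v)\<close>, \<open>(v, u)\<close>.

  The library's \<^verbatim>\<open>forest\<close> and \<^verbatim>\<open>tree\<close> are not usable for such graphs, because
  \<^verbatim>\<open>cycle\<close> admits the closed walk \<open>u, v, u\<close> along a single edge. The graph-theoretic
  cycles are those of length at least 3. Connected graphs are nonempty by definition.
\<close>

definition graph_tree :: "'a pair_pre_digraph \<Rightarrow> bool" where
  "graph_tree G \<longleftrightarrow> pair_graph G \<and> Digraph_Component.connected (with_proj G) \<and>
     \<not> (\<exists>p. pre_digraph.cycle (with_proj G) p \<and> 3 \<le> length p)"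

definition tree_on :: "nat \<Rightarrow> 'a pair_pre_digraph \<Rightarrow> bool" where
  "tree_on k G \<longleftrightarrow> graph_tree G \<and> card (pverts G) = k"

definition gen_indep :: "nat \<Rightarrow> 'a pair_pre_digraph \<Rightarrow> 'a set \<Rightarrow> bool" where
  "gen_indep k G S \<longleftrightarrow> S \<subseteq> pverts G \<and>
     \<not> (\<exists>H. tree_on k H \<and> subgraph (with_proj H) (with_proj G \<restriction> S))"

definition gen_indep_number :: "nat \<Rightarrow> 'a pair_pre_digraph \<Rightarrow> nat" where
  "gen_indep_number k G = Max {card S | S. gen_indep k G S}"

definition join_by_edge ::
  "'a pair_pre_digraph \<Rightarrow> 'a pair_pre_digraph \<Rightarrow> 'a \<Rightarrow> 'a \<Rightarrow> 'a pair_pre_digraph" where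
  "join_by_edge G H u v =
     \<lparr> pverts = pverts G \<union> pverts H, parcs = parcs G \<union> parcs H \<union> {(u, v), (v, u)} \<rparr>"

text \<open>
  The family is indexed by \<open>i \<ge> 1\<close>; the value at \<open>i = 0\<close> is a dummy. The summands are concrete
  graphs with disjoint vertex sets, so no isomorphism is needed to form their disjoint union.
\<close>

fun R_family :: "nat \<Rightarrow> nat \<Rightarrow> 'a pair_pre_digraph set" where
  "R_family k 0 = {}"
| "R_family k (Suc 0) = {T. tree_on k T}"
| "R_family k (Suc (Suc i)) =
     {T. graph_tree T \<and>
         (\<exists>T' T'' u v. T' \<in> R_family k (Suc i) \<and> tree_on k T'' \<and>
            pverts T' \<inter> pverts T'' = {} \<and> u \<in> pverts T' \<and> v \<in> pverts T'' \<and>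
            T = join_by_edge T' T'' u v)}"

lemma gen_indep_number_attained:
  assumes "finite (pverts G)" and "k \<ge> 1"
  shows "finite {card S | S. gen_indep k G S}" and "{card S | S. gen_indep k G S} \<noteq> {}"
proof -
  have "{card S | S. gen_indep k G S} \<subseteq> card ` Pow (pverts G)"
    by (auto simp: gen_indep_def)
  then show "finite {card S | S. gen_indep k G S}"
    using assms(1) by (meson finite_Pow_iff finite_imageI finite_subset)
  have "gen_indep k G {}"
    using assms(2) by (auto simp: gen_indep_def tree_on_def subgraph_def induce_subgraph_def)
  then show "{card S | S. gen_indep k G S} \<noteq> {}" by blast
qed

end

theory Submission
  imports Defs
begin

text \<open>
  A set is generalized \<open>k\<close>-independent iff every connected part of it has fewer than \<open>k\<close> vertices, so
  \<open>n - \<alpha>\<^sub>k(T)\<close> is the least number of vertices whose removal leaves only components with fewer than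
  \<open>k\<close> vertices. The bound says that \<open>n / k\<close> removals suffice, and the proof removes one vertex for every
  \<open>k\<close> vertices greedily from the leaves inwards.

  Cutting an edge at a vertex \<open>v\<close> of a tree splits the tree into the side \<open>A\<close> of \<open>v\<close> and a rest, both
  connected. Take such a branch \<open>A\<close> with at least \<open>k\<close> vertices that is as small as possible (or the whole
  tree, if no proper branch is that large). A component of \<open>A - v\<close> with \<open>k\<close> or more vertices would be a
  smaller branch of the same kind, so all components of \<open>A - v\<close> have fewer than \<open>k\<close> vertices
  (\<open>exists_last_big_branch\<close>). All edges from \<open>A\<close> to the rest leave at \<open>v\<close>, so \<open>A - v\<close> can be added to any
  generalized \<open>k\<close>-independent set of the rest (\<open>gen_indep_insert_branch\<close>). Thus a single removal accounts
  for \<open>|A| \<ge> k\<close> vertices, and induction on the rest gives the bound.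

  The same induction settles when the bound is attained. It is exceeded as soon as some \<open>|A| > k\<close>, or
  when a nonempty rest of fewer than \<open>k\<close> vertices remains. Otherwise every branch is a tree on exactly \<open>k\<close>
  vertices attached by a single edge to the rest, which is the recursive description of \<open>R\<^sub>i\<^sup>k\<close>
  (\<open>large_gen_indep_or_R_family\<close>). Conversely, a member of \<open>R\<^sub>i\<^sup>k\<close> is partitioned into \<open>i\<close> subtrees on \<open>k\<close>
  vertices, and an independent set misses a vertex of each (\<open>R_family_gen_indep_card_le\<close>).
\<close>

section \<open>Induced subgraphs and connectivity\<close>

text \<open>
  This is the restriction of \<open>with_proj G\<close> to \<open>S\<close>, but as a pair digraph, the type on which \<open>graph_tree\<close>
  and \<open>join_by_edge\<close> operate.
\<close>

definition induced :: "'a pair_pre_digraph \<Rightarrow> 'a set \<Rightarrow> 'a pair_pre_digraph" where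
  "induced G S = \<lparr> pverts = S, parcs = parcs G \<inter> S \<times> S \<rparr>"

lemma induced_simps [simp]:
  "pverts (induced G S) = S"
  "parcs (induced G S) = parcs G \<inter> S \<times> S"
  by (simp_all add: induced_def)

lemma pair_graph_iff:
  "pair_graph G \<longleftrightarrow> finite (pverts G) \<and> parcs G \<subseteq> pverts G \<times> pverts G \<and>
     sym (parcs G) \<and> (\<forall>v. (v, v) \<notin> parcs G)"
proof
  assume "pair_graph G"
  then interpret pair_graph G .
  show "finite (pverts G) \<and> parcs G \<subseteq> pverts G \<times> pverts G \<and>
     sym (parcs G) \<and> (\<forall>v. (v, v) \<notin> parcs G)"
    using pair_sym_arcs pair_finite_verts pair_no_loops wellformed'
    by (fastforce simp: symmetric_def)
next
  assume *: "finite (pverts G) \<and> parcs G \<subseteq> pverts G \<times> pverts G \<and>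
     sym (parcs G) \<and> (\<forall>v. (v, v) \<notin> parcs G)"
  then have "finite (parcs G)"
    by (meson finite_SigmaI finite_subset)
  with * show "pair_graph G"
    by unfold_locales (auto simp: symmetric_def)
qed

lemma pair_graph_induced:
  "pair_graph G \<Longrightarrow> S \<subseteq> pverts G \<Longrightarrow> pair_graph (induced G S)"
  unfolding pair_graph_iff by (auto simp: finite_subset sym_def)

lemma induced_pverts:
  "pair_graph G \<Longrightarrow> induced G (pverts G) = G"
  unfolding pair_graph_iff by (cases G) (auto simp: induced_def)

lemma connected_iff_reachable:
  assumes "pair_graph G"
  shows "connected (with_proj G) \<longleftrightarrow>
    pverts G \<noteq> {} \<and> (\<forall>u \<in> pverts G. \<forall>v \<in> pverts G. u \<rightarrow>\<^sup>*\<^bsub>with_proj G\<^esub> v)"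
proof -
  interpret pair_graph G by fact
  show ?thesis
    unfolding connected_def strongly_connected_def
    using reachable_mk_symmetric_eq[OF pair_sym_arcs] by auto
qed

text \<open>
  Connectivity is used below almost only in this form: subgraphs then never have to be compared walk by
  walk, since closed sets are easy to restrict and to extend.
\<close>

lemma connected_iff_no_proper_closed:
  assumes G: "pair_graph G"
  shows "connected (with_proj G) \<longleftrightarrow> pverts G \<noteq> {} \<and>
    (\<forall>X \<subseteq> pverts G. X \<noteq> {} \<longrightarrow> (\<forall>(x, y) \<in> parcs G. x \<in> X \<longrightarrow> y \<in> X) \<longrightarrow> X = pverts G)"
    (is "_ \<longleftrightarrow> _ \<and> ?closed")
proof -
  interpret pair_graph G by fact
  let ?reach = "\<forall>u \<in> pverts G. \<forall>v \<in> pverts G. u \<rightarrow>\<^sup>*\<^bsub>with_proj G\<^esub> v"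
  have "?closed" if conn: ?reach
  proof (intro allI impI)
    fix X assume X: "X \<subseteq> pverts G" "X \<noteq> {}" "\<forall>(x, y) \<in> parcs G. x \<in> X \<longrightarrow> y \<in> X"
    then obtain x where x: "x \<in> X" by blast
    have "y \<in> X" if "y \<in> pverts G" for y
    proof -
      have "(x, y) \<in> rtrancl_on (pverts G) (parcs G)"
        using conn x that X(1) unfolding reachable_def by auto
      then show ?thesis
        using x by induction (use X(3) in auto)
    qed
    with X show "X = pverts G" by blast
  qed
  moreover have ?reach if cl: ?closed
  proof (intro ballI)
    fix u v assume u: "u \<in> pverts G" and v: "v \<in> pverts G"
    let ?X = "{w. u \<rightarrow>\<^sup>*\<^bsub>with_proj G\<^esub> w}"
    have "?X \<subseteq> pverts G" using reachable_in_verts(2) by auto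
    moreover have "u \<in> ?X" using u by simp
    moreover have "\<forall>(x, y) \<in> parcs G. x \<in> ?X \<longrightarrow> y \<in> ?X"
      using reachable_adj_trans by auto
    ultimately have "?X = pverts G" using cl by blast
    with v show "u \<rightarrow>\<^sup>*\<^bsub>with_proj G\<^esub> v" by blast
  qed
  ultimately have "?reach \<longleftrightarrow> ?closed" by (rule iffI)
  then show ?thesis
    unfolding connected_iff_reachable[OF G] by (rule arg_cong)
qed

lemma connected_closed_eq:
  assumes "pair_graph G" "connected (with_proj G)" "X \<subseteq> pverts G" "X \<noteq> {}"
    and "\<And>x y. (x, y) \<in> parcs G \<Longrightarrow> x \<in> X \<Longrightarrow> y \<in> X"
  shows "X = pverts G"
  using assms unfolding connected_iff_no_proper_closed[OF assms(1)] by (auto simp: Ball_def)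

lemma connected_induced_closed_eq:
  assumes "pair_graph G" "S \<subseteq> pverts G" "connected (with_proj (induced G S))" "X \<subseteq> S" "X \<noteq> {}"
    and "\<And>x y. (x, y) \<in> parcs G \<Longrightarrow> x \<in> X \<Longrightarrow> y \<in> S \<Longrightarrow> y \<in> X"
  shows "X = S"
proof -
  have "X = pverts (induced G S)"
    by (rule connected_closed_eq[OF pair_graph_induced[OF assms(1,2)] assms(3)])
      (use assms(4-6) in auto)
  then show ?thesis by simp
qed

lemma connected_inducedI:
  assumes "pair_graph G" "S \<subseteq> pverts G" "S \<noteq> {}"
    and "\<And>X. X \<subseteq> S \<Longrightarrow> X \<noteq> {} \<Longrightarrow>
      (\<And>x y. (x, y) \<in> parcs G \<Longrightarrow> x \<in> X \<Longrightarrow> y \<in> S \<Longrightarrow> y \<in> X) \<Longrightarrow> X = S"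
  shows "connected (with_proj (induced G S))"
  unfolding connected_iff_no_proper_closed[OF pair_graph_induced[OF assms(1,2)]]
proof (intro conjI allI impI)
  fix X assume X: "X \<subseteq> pverts (induced G S)" "X \<noteq> {}"
    "\<forall>(a, b) \<in> parcs (induced G S). a \<in> X \<longrightarrow> b \<in> X"
  have "X = S" by (rule assms(4)) (use X in auto)
  then show "X = pverts (induced G S)" by simp
qed (use assms(3) in simp)

lemma connected_nonempty: "connected (with_proj G) \<Longrightarrow> pverts G \<noteq> {}"
  by (simp add: connected_def strongly_connected_def)

lemma connected_insert:
  assumes G: "pair_graph G" and S: "insert y S \<subseteq> pverts G" "connected (with_proj (induced G S))"
    and xy: "x \<in> S" "(x, y) \<in> parcs G"
  shows "connected (with_proj (induced G (insert y S)))"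
proof (rule connected_inducedI[OF G S(1)])
  fix X assume X: "X \<subseteq> insert y S" "X \<noteq> {}"
    "\<And>a b. (a, b) \<in> parcs G \<Longrightarrow> a \<in> X \<Longrightarrow> b \<in> insert y S \<Longrightarrow> b \<in> X"
  have yx: "(y, x) \<in> parcs G"
    using G xy(2) by (auto simp: pair_graph_iff dest: symD)
  have "S \<subseteq> pverts G" using S(1) by blast
  moreover have "X \<inter> S \<noteq> {}" using X(1,2) X(3)[OF yx] xy(1) by blast
  ultimately have "X \<inter> S = S"
    using X(3) by (intro connected_induced_closed_eq[OF G _ S(2)]) auto
  then have "x \<in> X" "S \<subseteq> X" using xy(1) by auto
  then show "X = insert y S"
    using X(1) X(3)[OF xy(2)] by blast
qed auto

text \<open>
  Of the two sides of a split of \<open>V - S\<close> into parts without edges between them, one misses \<open>v\<close>. That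
  side then has no edge to \<open>S\<close> either, so it is closed in all of \<open>G\<close>.
\<close>

lemma connected_Diff_single_neighbour:
  assumes G: "pair_graph G" and conn: "connected (with_proj G)" and S: "S \<subseteq> pverts G"
    and v: "v \<in> pverts G - S"
    and leave: "\<And>x y. (x, y) \<in> parcs G \<Longrightarrow> x \<in> S \<Longrightarrow> y \<notin> S \<Longrightarrow> y = v"
  shows "connected (with_proj (induced G (pverts G - S)))"
proof (rule connected_inducedI[OF G])
  have arcs: "parcs G \<subseteq> pverts G \<times> pverts G" and sym: "sym (parcs G)"
    using G by (auto simp: pair_graph_iff)
  have whole: "Y = pverts G" if "Y \<subseteq> pverts G - S" "Y \<noteq> {}" "v \<notin> Y"
    and Y: "\<And>a b. (a, b) \<in> parcs G \<Longrightarrow> a \<in> Y \<Longrightarrow> b \<notin> S \<Longrightarrow> b \<in> Y" for Y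
  proof -
    have "b \<in> Y" if ab: "(a, b) \<in> parcs G" "a \<in> Y" for a b
    proof -
      have "(b, a) \<in> parcs G" using sym ab(1) by (rule symD)
      then have "b \<notin> S" using leave[of b a] ab(2) \<open>Y \<subseteq> _\<close> \<open>v \<notin> Y\<close> by blast
      then show ?thesis using Y ab by blast
    qed
    then show ?thesis
      using connected_closed_eq[OF G conn, of Y] that(1,2) by blast
  qed
  fix X assume X: "X \<subseteq> pverts G - S" "X \<noteq> {}"
    "\<And>a b. (a, b) \<in> parcs G \<Longrightarrow> a \<in> X \<Longrightarrow> b \<in> pverts G - S \<Longrightarrow> b \<in> X"
  have X': "b \<in> X" if "(a, b) \<in> parcs G" "a \<in> X" "b \<notin> S" for a b
    using X(3)[of a b] that arcs by blast
  have "v \<in> X" using whole[of X] X(1,2) X' v by blast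
  let ?Y = "pverts G - S - X"
  have Y': "b \<in> ?Y" if "(a, b) \<in> parcs G" "a \<in> ?Y" "b \<notin> S" for a b
    using that arcs X'[of b a] symD[OF sym that(1)] by blast
  have "?Y = {}"
  proof (rule ccontr)
    assume "?Y \<noteq> {}"
    then have "?Y = pverts G" using whole[of ?Y] Y' \<open>v \<in> X\<close> by blast
    then show False using v \<open>v \<in> X\<close> by blast
  qed
  then show "X = pverts G - S" using X(1) by blast
qed (use v in auto)

section \<open>Pieces of a tree\<close>

lemma graph_tree_induced:
  assumes "graph_tree T" "S \<subseteq> pverts T" "connected (with_proj (induced T S))"
  shows "graph_tree (induced T S)"
proof -
  have "pre_digraph.cycle (with_proj T) p" if "pre_digraph.cycle (with_proj (induced T S)) p" for p
    using that assms(2)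
    by (auto simp: pre_digraph.cycle_def pre_digraph.awalk_def cas_with_proj_eq awalk_verts_with_proj_eq)
  with assms show ?thesis
    unfolding graph_tree_def by (blast intro: pair_graph_induced)
qed

text \<open>
  Two different neighbours of \<open>v\<close> in \<open>C\<close> are joined by a path inside \<open>C\<close>, which \<open>v\<close> closes to a cycle.
\<close>

lemma unique_attachment:
  assumes T: "graph_tree T" and C: "C \<subseteq> pverts T" "connected (with_proj (induced T C))"
    and v: "v \<notin> C" and x: "x \<in> C" "(v, x) \<in> parcs T" and y: "y \<in> C" "(v, y) \<in> parcs T"
  shows "x = y"
proof (rule ccontr)
  assume "x \<noteq> y"
  interpret T: pair_graph T using T by (simp add: graph_tree_def)
  interpret C: pair_graph "induced T C"
    using T C by (simp add: graph_tree_def pair_graph_induced)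
  have "x \<rightarrow>\<^sup>*\<^bsub>with_proj (induced T C)\<^esub> y"
    using C(2) x y by (simp add: connected_iff_reachable C.pair_graph)
  then obtain p where p: "C.apath x p y"
    using C.reachable_apath by blast
  then have p_T: "T.awalk x p y" and "distinct (pawalk_verts x p)"
    using C(1) by (auto simp: C.apath_def C.awalk_def T.awalk_def)
  have p_C: "set (pawalk_verts x p) \<subseteq> C"
  proof
    fix z assume "z \<in> set (pawalk_verts x p)"
    with p show "z \<in> C"
      using C.awalk_verts_in_verts[of x p z] by (simp add: C.apath_def C.awalk_def)
  qed
  have yv: "(y, v) \<in> parcs T"
    using y T.arcs_symmetric by blast
  let ?c = "(v, x) # p @ [(y, v)]"
  have "T.awalk v ?c v"
    using p_T x yv T.wellformed' by (auto simp: T.awalk_simps)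
  moreover have "tl (pawalk_verts v ?c) = pawalk_verts x p @ [v]"
    using p_T T.awalk_verts_append[of x p "[(y, v)]" v] yv T.wellformed'
    by (auto simp: T.awalk_simps)
  ultimately have "T.cycle ?c"
    using \<open>distinct _\<close> p_C v unfolding T.cycle_def by auto
  moreover have "p \<noteq> []"
    using p \<open>x \<noteq> y\<close> by (auto simp: C.apath_def C.awalk_def)
  then have "3 \<le> length ?c" by (cases p) auto
  ultimately show False
    using T unfolding graph_tree_def by blast
qed

section \<open>Cutting off a branch\<close>

text \<open>
  Arcs of \<open>H\<close> have their ends in \<open>pverts H\<close>, so being a subgraph of the restriction of \<open>G\<close> to \<open>S\<close> only
  requires the vertices to lie in \<open>S\<close> and the arcs to be arcs of \<open>G\<close>.
\<close>

lemma gen_indep_iff: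
  assumes "pair_graph G"
  shows "gen_indep k G S \<longleftrightarrow>
    S \<subseteq> pverts G \<and> (\<forall>H. tree_on k H \<longrightarrow> pverts H \<subseteq> S \<longrightarrow> parcs H \<subseteq> parcs G \<longrightarrow> False)"
proof -
  have eq: "with_proj G \<restriction> S = with_proj (induced G S)"
    by (auto simp: induce_subgraph_def with_proj_def)
  have "subgraph (with_proj H) (with_proj G \<restriction> S) \<longleftrightarrow> pverts H \<subseteq> S \<and> parcs H \<subseteq> parcs G"
    if "tree_on k H" "S \<subseteq> pverts G" for H
  proof -
    have H: "pair_graph H" and GS: "pair_graph (induced G S)"
      using that assms by (auto simp: tree_on_def graph_tree_def pair_graph_induced)
    have "wf_digraph (with_proj H)" "wf_digraph (with_proj (induced G S))"
      using H GS by (simp_all add: wf_digraph_wp_iff pair_digraph.pair_wf_digraph pair_graph.axioms)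
    then show ?thesis
      unfolding eq subgraph_def
      using H by (auto simp: pair_graph_iff compatibleI_with_proj)
  qed
  then show ?thesis
    unfolding gen_indep_def by blast
qed

text \<open>
  In a rooted tree one would take for \<open>v\<close> a deepest vertex with at least \<open>k\<close> descendants and for \<open>A\<close> these
  descendants. Minimality of \<open>card A\<close> among all sets with the first six properties plays this role
  without a root: from a large component \<open>D\<close> of \<open>A - v\<close> all edges leave towards \<open>v\<close>, and in fact from a
  single vertex \<open>w\<close> of \<open>D\<close>, so \<open>(D, w)\<close> would be a smaller choice.
\<close>

lemma exists_last_big_branch:
  assumes T: "graph_tree T" and k: "k \<le> card (pverts T)"
  obtains A v where "A \<subseteq> pverts T" "v \<in> A" "k \<le> card A"
    "connected (with_proj (induced T A))"
    "A \<noteq> pverts T \<Longrightarrow> connected (with_proj (induced T (pverts T - A)))"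
    "\<And>x y. (x, y) \<in> parcs T \<Longrightarrow> x \<in> A \<Longrightarrow> y \<notin> A \<Longrightarrow> x = v"
    "\<And>C. C \<subseteq> A - {v} \<Longrightarrow> connected (with_proj (induced T C)) \<Longrightarrow> card C < k"
proof -
  have G: "pair_graph T" and conn: "connected (with_proj T)"
    using T by (auto simp: graph_tree_def)
  define branch where "branch A v \<longleftrightarrow> A \<subseteq> pverts T \<and> v \<in> A \<and> k \<le> card A \<and>
    connected (with_proj (induced T A)) \<and>
    (A \<noteq> pverts T \<longrightarrow> connected (with_proj (induced T (pverts T - A)))) \<and>
    (\<forall>x y. (x, y) \<in> parcs T \<longrightarrow> x \<in> A \<longrightarrow> y \<notin> A \<longrightarrow> x = v)" for A v
  have fin: "finite (pverts T)" and arcs: "parcs T \<subseteq> pverts T \<times> pverts T" and sym: "sym (parcs T)"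
    using G by (auto simp: pair_graph_iff)
  obtain r where "r \<in> pverts T"
    using connected_nonempty[OF conn] by blast
  then have "branch (pverts T) r"
    unfolding branch_def using k conn arcs by (auto simp: induced_pverts[OF G])
  then obtain A where "\<exists>v. branch A v" and min: "\<And>B w. branch B w \<Longrightarrow> card A \<le> card B"
    using ex_has_least_nat[of "\<lambda>A. \<exists>v. branch A v" "pverts T" card] by metis
  then obtain v where Av: "branch A v" by blast
  have A: "A \<subseteq> pverts T" "v \<in> A" and leave: "\<And>x y. (x, y) \<in> parcs T \<Longrightarrow> x \<in> A \<Longrightarrow> y \<notin> A \<Longrightarrow> x = v"
    using Av by (auto simp: branch_def)
  have small: "card C < k" if C: "C \<subseteq> A - {v}" "connected (with_proj (induced T C))" for C
  proof (rule ccontr)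
    assume "\<not> card C < k"
    \<comment> \<open>A component of \<open>A - v\<close> is obtained as a connected subset of maximal size.\<close>
    define conn_part where "conn_part D \<longleftrightarrow> D \<subseteq> A - {v} \<and> connected (with_proj (induced T D))" for D
    have "conn_part C" using C by (simp add: conn_part_def)
    moreover have "\<forall>D. conn_part D \<longrightarrow> card D < Suc (card A)"
      using A fin by (auto simp: conn_part_def less_Suc_eq_le intro!: card_mono intro: finite_subset)
    ultimately obtain D where D: "conn_part D" and max: "\<And>E. conn_part E \<Longrightarrow> card E \<le> card D"
      using ex_has_greatest_nat[of conn_part C card "Suc (card A)"] by blast
    have DA: "D \<subseteq> A" "v \<notin> D" and D_conn: "connected (with_proj (induced T D))"
      using D by (auto simp: conn_part_def)
    have DT: "D \<subseteq> pverts T" using DA A by blast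
    have "k \<le> card D" using max[OF \<open>conn_part C\<close>] \<open>\<not> card C < k\<close> by simp
    have D_closed: "y = v" if xy: "(x, y) \<in> parcs T" "x \<in> D" "y \<notin> D" for x y
    proof (rule ccontr)
      assume "y \<noteq> v"
      have "y \<in> A" using leave xy DA by blast
      have yT: "insert y D \<subseteq> pverts T" using DT xy arcs by blast
      have "connected (with_proj (induced T (insert y D)))"
        by (rule connected_insert[OF G yT D_conn xy(2,1)])
      then have "conn_part (insert y D)"
        using D \<open>y \<in> A\<close> \<open>y \<noteq> v\<close> by (auto simp: conn_part_def)
      from max[OF this] show False
        using xy DT fin finite_subset by (fastforce simp: card_insert_if)
    qed
    have "D \<noteq> pverts T" using DA A by blast
    moreover have "D \<noteq> {}" using connected_nonempty[OF D_conn] by simp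
    ultimately obtain w z where w: "w \<in> D" "(w, z) \<in> parcs T" "z \<notin> D"
      using connected_closed_eq[OF G conn DT] by blast
    have "branch D w"
      unfolding branch_def
    proof (intro conjI allI impI)
      fix x y assume xy: "(x, y) \<in> parcs T" "x \<in> D" "y \<notin> D"
      have "y = v" "z = v" using D_closed xy w by blast+
      then show "x = w"
        using unique_attachment[OF T DT D_conn] DA xy w sym by (meson symD)
    next
      show "connected (with_proj (induced T (pverts T - D)))"
        by (rule connected_Diff_single_neighbour[OF G conn DT]) (use A DA D_closed in auto)
    qed (use DT w D_conn \<open>k \<le> card D\<close> in auto)
    then have "card A \<le> card D" using min by blast
    moreover have "card D < card A"
      using A DA fin by (intro psubset_card_mono) (auto intro: finite_subset)
    ultimately show False by simp
  qed
  show thesis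
    using that[of A v] Av small unfolding branch_def by blast
qed

text \<open>
  There are no edges between \<open>A - v\<close> and the complement of \<open>A\<close>, so a tree on \<open>k\<close> vertices in the union
  lies on one of the two sides; on the side of \<open>A\<close> its vertex set would be too large a connected set.
\<close>

lemma gen_indep_insert_branch:
  assumes G: "pair_graph T" and A: "A \<subseteq> pverts T" and AV: "v \<in> A"
    and leave: "\<And>x y. (x, y) \<in> parcs T \<Longrightarrow> x \<in> A \<Longrightarrow> y \<notin> A \<Longrightarrow> x = v"
    and small: "\<And>C. C \<subseteq> A - {v} \<Longrightarrow> connected (with_proj (induced T C)) \<Longrightarrow> card C < k"
    and S: "gen_indep k (induced T (pverts T - A)) S"
  shows "gen_indep k T (S \<union> (A - {v}))"
proof -
  have G': "pair_graph (induced T (pverts T - A))"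
    using G by (simp add: pair_graph_induced)
  have SV: "S \<subseteq> pverts T - A" using S by (simp add: gen_indep_def)
  have False if H: "tree_on k H" "pverts H \<subseteq> S \<union> (A - {v})" "parcs H \<subseteq> parcs T" for H
  proof -
    have GH: "pair_graph H" and conn: "connected (with_proj H)" and card: "card (pverts H) = k"
      using H by (auto simp: tree_on_def graph_tree_def)
    have arcs: "parcs H \<subseteq> pverts H \<times> pverts H"
      using GH by (auto simp: pair_graph_iff)
    have HV: "pverts H \<subseteq> pverts T" using H SV A by blast
    have "pverts H \<inter> A = {} \<or> pverts H \<inter> A = pverts H"
    proof -
      have "y \<in> pverts H \<inter> A" if xy: "(x, y) \<in> parcs H" "x \<in> pverts H \<inter> A" for x y
      proof -
        have "(x, y) \<in> parcs T" "y \<in> pverts H" using xy H(3) arcs by auto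
        moreover have "x \<noteq> v" using xy(2) H(2) SV AV by blast
        ultimately show ?thesis using leave[of x y] xy(2) by blast
      qed
      then show ?thesis
        using connected_closed_eq[OF GH conn, of "pverts H \<inter> A"] by blast
    qed
    then show False
    proof
      assume "pverts H \<inter> A = {}"
      then have "pverts H \<subseteq> S" using H by blast
      moreover have "parcs H \<subseteq> parcs (induced T (pverts T - A))"
        using H arcs \<open>pverts H \<subseteq> S\<close> SV by auto
      ultimately show False
        using S H(1) unfolding gen_indep_iff[OF G'] by blast
    next
      assume "pverts H \<inter> A = pverts H"
      then have "pverts H \<subseteq> A - {v}" using H SV by blast
      moreover have "connected (with_proj (induced T (pverts H)))"
      proof (rule connected_inducedI[OF G HV connected_nonempty[OF conn]])
        fix X assume X: "X \<subseteq> pverts H" "X \<noteq> {}"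
          "\<And>x y. (x, y) \<in> parcs T \<Longrightarrow> x \<in> X \<Longrightarrow> y \<in> pverts H \<Longrightarrow> y \<in> X"
        show "X = pverts H"
          by (rule connected_closed_eq[OF GH conn X(1,2)]) (use X(3) arcs H(3) in blast)
      qed
      ultimately show False using small card by blast
    qed
  qed
  then show ?thesis
    unfolding gen_indep_iff[OF G] using SV A by blast
qed

text \<open>
  The edges between \<open>A\<close> and the rest all start at \<open>v\<close>, and \<open>v\<close> has only one neighbour in the connected
  rest by \<open>unique_attachment\<close>.
\<close>

lemma join_branch:
  assumes T: "graph_tree T" and A: "A \<subseteq> pverts T" "v \<in> A" "A \<noteq> pverts T"
    and conn: "connected (with_proj (induced T (pverts T - A)))"
    and leave: "\<And>x y. (x, y) \<in> parcs T \<Longrightarrow> x \<in> A \<Longrightarrow> y \<notin> A \<Longrightarrow> x = v"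
  obtains u where "u \<in> pverts T - A"
    "T = join_by_edge (induced T (pverts T - A)) (induced T A) u v"
proof -
  have G: "pair_graph T" and "connected (with_proj T)"
    using T by (auto simp: graph_tree_def)
  have arcs: "parcs T \<subseteq> pverts T \<times> pverts T" and sym: "sym (parcs T)"
    using G by (auto simp: pair_graph_iff)
  obtain x u where xu: "(x, u) \<in> parcs T" "x \<in> A" "u \<notin> A"
    using connected_closed_eq[OF G \<open>connected (with_proj T)\<close> A(1)] A(2,3) by blast
  have vu: "(v, u) \<in> parcs T" "(u, v) \<in> parcs T" "u \<in> pverts T - A"
    using xu leave sym arcs by (auto dest: symD)
  have unique: "y = u" if "(v, y) \<in> parcs T" "y \<notin> A" for y
    by (rule unique_attachment[OF T _ conn, of v]) (use that vu A arcs in auto)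
  have "parcs T = parcs T \<inter> (pverts T - A) \<times> (pverts T - A) \<union> parcs T \<inter> A \<times> A \<union> {(u, v), (v, u)}"
    (is "_ = ?R")
  proof
    show "parcs T \<subseteq> ?R"
    proof
      fix e assume e: "e \<in> parcs T"
      obtain a b where ab: "e = (a, b)" by (cases e)
      have "(b, a) \<in> parcs T" using e ab sym by (auto dest: symD)
      then show "e \<in> ?R"
        using e ab arcs leave[of a b] leave[of b a] unique[of a] unique[of b] by blast
    qed
  qed (use vu in auto)
  then have "T = join_by_edge (induced T (pverts T - A)) (induced T A) u v"
    using A by (cases T) (auto simp: join_by_edge_def)
  with vu show thesis using that by blast
qed

section \<open>The lower bound and the extremal trees\<close>

text \<open>
  Trees with fewer than \<open>k\<close> vertices are included, as they can occur as the rest after a branch is cut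
  off; for them the whole vertex set exceeds the bound. Stating the bound and the structure of the
  extremal trees as one alternative lets both pass through a single induction.
\<close>

lemma large_gen_indep_or_R_family:
  assumes "graph_tree T" and "k \<ge> 2"
  shows "\<exists>S. gen_indep k T S \<and> (k * card S > (k - 1) * card (pverts T) \<or>
    k * card S = (k - 1) * card (pverts T) \<and>
    k dvd card (pverts T) \<and> T \<in> R_family k (card (pverts T) div k))"
  using assms(1)
proof (induction "card (pverts T)" arbitrary: T rule: less_induct)
  case less
  let ?V = "pverts T"
  have G: "pair_graph T" and conn: "connected (with_proj T)"
    using less.prems by (auto simp: graph_tree_def)
  have fin: "finite ?V" using G by (simp add: pair_graph_iff)
  have "?V \<noteq> {}" using connected_nonempty[OF conn] .
  then have pos: "card ?V > 0" using fin by (simp add: card_gt_0_iff)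
  show ?case
  proof (cases "card ?V < k")
    case True
    have "card (pverts H) \<noteq> k" if "pverts H \<subseteq> ?V" for H :: "'a pair_pre_digraph"
      using card_mono[OF fin that] True by simp
    then have "gen_indep k T ?V"
      unfolding gen_indep_iff[OF G] tree_on_def by blast
    moreover have "k * card ?V > (k - 1) * card ?V" using pos \<open>k \<ge> 2\<close> by simp
    ultimately show ?thesis by blast
  next
    case False
    then have "k \<le> card ?V" by simp
    with less.prems obtain A v where A: "A \<subseteq> ?V" "v \<in> A" "k \<le> card A"
      "connected (with_proj (induced T A))"
      "A \<noteq> ?V \<Longrightarrow> connected (with_proj (induced T (?V - A)))"
      and leave: "\<And>x y. (x, y) \<in> parcs T \<Longrightarrow> x \<in> A \<Longrightarrow> y \<notin> A \<Longrightarrow> x = v"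
      and small: "\<And>C. C \<subseteq> A - {v} \<Longrightarrow> connected (with_proj (induced T C)) \<Longrightarrow> card C < k"
      by (rule exists_last_big_branch) blast
    let ?R = "induced T (?V - A)"
    have finA: "finite A" using A(1) fin finite_subset by blast
    have R: "pair_graph ?R" by (simp add: G pair_graph_induced)
    have card_A: "card (A - {v}) = card A - 1" using A(2) finA by simp
    have insert_branch: "gen_indep k T (S \<union> (A - {v}))" if "gen_indep k ?R S" for S
      by (rule gen_indep_insert_branch[OF G A(1,2) _ _ that]) (use leave small in blast)+
    show ?thesis
    proof (cases "A = ?V")
      case True
      have "gen_indep k ?R {}"
        unfolding gen_indep_iff[OF R] tree_on_def using \<open>k \<ge> 2\<close> by auto
      then have S: "gen_indep k T (A - {v})" using insert_branch[of "{}"] by simp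
      obtain d where d: "card A = k + d" using A(3) le_Suc_ex by blast
      obtain j where j: "k = Suc j" using \<open>k \<ge> 2\<close> by (cases k) auto
      show ?thesis
      proof (cases "d = 0")
        case True
        then have "T \<in> R_family k (card ?V div k)"
          using d \<open>A = ?V\<close> less.prems \<open>k \<ge> 2\<close> by (simp add: tree_on_def)
        then show ?thesis
          using S d True \<open>A = ?V\<close> card_A by (intro exI[of _ "A - {v}"]) simp
      next
        case False
        then show ?thesis
          using S d card_A j \<open>A = ?V\<close> by (intro exI[of _ "A - {v}"]) (simp add: algebra_simps)
      qed
    next
      case False
      then have R_tree: "graph_tree ?R"
        using A(5) less.prems by (simp add: graph_tree_induced)
      have card_V: "card ?V = card (?V - A) + card A"
        using A(1) fin finA by (simp add: card_Diff_subset card_mono)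
      have "card (pverts ?R) < card ?V"
        using card_V A(3) \<open>k \<ge> 2\<close> by simp
      from less.hyps[OF this R_tree] obtain S where S: "gen_indep k ?R S"
        and S_card: "k * card S > (k - 1) * card (?V - A) \<or>
          k * card S = (k - 1) * card (?V - A) \<and>
          k dvd card (?V - A) \<and> ?R \<in> R_family k (card (?V - A) div k)"
        by auto
      have "S \<subseteq> ?V - A" using S by (simp add: gen_indep_def)
      then have card_U: "card (S \<union> (A - {v})) = card S + (card A - 1)"
        using finA fin finite_subset card_A by (subst card_Un_disjoint) auto
      \<comment> \<open>The excess \<open>d\<close> and the predecessor \<open>j\<close> turn the inequalities into ones without subtraction.\<close>
      obtain d where d: "card A = k + d" using A(3) le_Suc_ex by blast
      obtain j where j: "k = Suc j" using \<open>k \<ge> 2\<close> by (cases k) auto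
      have U: "gen_indep k T (S \<union> (A - {v}))" using insert_branch[OF S] .
      show ?thesis
      proof (cases "k * card S > (k - 1) * card (?V - A) \<or> d > 0")
        case True
        then have "k * card (S \<union> (A - {v})) > (k - 1) * card ?V"
          using S_card unfolding card_U card_V d j by (auto simp: algebra_simps)
        with U show ?thesis by blast
      next
        case False
        then have eq: "k * card S = (k - 1) * card (?V - A)" and dvd: "k dvd card (?V - A)"
          and fam: "?R \<in> R_family k (card (?V - A) div k)" and "card A = k"
          using S_card d by auto
        then obtain m where m: "card (?V - A) = k * m" by auto
        \<comment> \<open>The rest is a member of the family, which is empty at index 0.\<close>
        have "m \<noteq> 0"
        proof
          assume "m = 0"
          then show False using m fam by simp
        qed
        then obtain i where i: "m = Suc i" by (cases m) auto
        obtain u where u: "u \<in> ?V - A" "T = join_by_edge ?R (induced T A) u v"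
          by (rule join_branch[OF less.prems A(1,2) \<open>A \<noteq> ?V\<close> A(5)[OF \<open>A \<noteq> ?V\<close>]])
            (use leave in blast)+
        have "tree_on k (induced T A)"
          using A less.prems \<open>card A = k\<close> by (simp add: tree_on_def graph_tree_induced)
        moreover have "?R \<in> R_family k (Suc i)"
          using fam \<open>k \<ge> 2\<close> unfolding m i by (simp del: R_family.simps)
        ultimately have fam_T: "T \<in> R_family k (Suc (Suc i))"
          unfolding R_family.simps
          using less.prems u A(2) by fastforce
        have n: "card ?V = k * Suc (Suc i)"
          using card_V m i \<open>card A = k\<close> by simp
        have "k * card (S \<union> (A - {v})) = (k - 1) * card ?V"
          using eq unfolding card_U card_V \<open>card A = k\<close> j by (simp add: algebra_simps)
        moreover have "k dvd card ?V" "card ?V div k = Suc (Suc i)"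
          using n \<open>k \<ge> 2\<close> by simp_all
        ultimately show ?thesis
          using U fam_T by (intro exI[of _ "S \<union> (A - {v})"]) (simp del: R_family.simps)
      qed
    qed
  qed
qed

section \<open>The upper bound for the family\<close>

lemma R_family_graph_tree: "T \<in> R_family k i \<Longrightarrow> graph_tree T"
  by (cases "(k, i)" rule: R_family.cases) (auto simp: tree_on_def)

lemma gen_indep_card_Int_tree_le:
  assumes "tree_on k H" "gen_indep k G S" "pair_graph G" "parcs H \<subseteq> parcs G"
  shows "card (S \<inter> pverts H) \<le> k - 1"
proof -
  have "finite (pverts H)" "card (pverts H) = k"
    using assms(1) by (auto simp: tree_on_def graph_tree_def pair_graph_iff)
  moreover have "\<not> pverts H \<subseteq> S"
    using assms unfolding gen_indep_iff[OF assms(3)] by blast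
  ultimately have "card (S \<inter> pverts H) < k"
    by (metis Int_lower2 inf.absorb_iff2 psubsetI psubset_card_mono)
  then show ?thesis by simp
qed

lemma R_family_gen_indep_card_le:
  "T \<in> R_family k i \<Longrightarrow> gen_indep k T S \<Longrightarrow> card S \<le> i * (k - 1)"
proof (induction i arbitrary: T S rule: induct_nat_012)
  case 0
  then show ?case by simp
next
  case 1
  then have "pair_graph T" "tree_on k T" "S \<subseteq> pverts T"
    by (auto simp: tree_on_def graph_tree_def gen_indep_def)
  then show ?case
    using gen_indep_card_Int_tree_le[of k T T S] 1 by (simp add: Int_absorb2)
next
  case (ge2 i)
  then obtain T' T'' u v where T: "graph_tree T" "T' \<in> R_family k (Suc i)" "tree_on k T''"
    "T = join_by_edge T' T'' u v"
    by auto
  have G: "pair_graph T" and G': "pair_graph T'"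
    using T R_family_graph_tree by (auto simp: graph_tree_def)
  have "gen_indep k T' (S \<inter> pverts T')"
    using ge2.prems(2) T(4) unfolding gen_indep_iff[OF G] gen_indep_iff[OF G']
    by (auto simp: join_by_edge_def)
  then have "card (S \<inter> pverts T') \<le> Suc i * (k - 1)"
    using ge2.IH(2) T(2) by blast
  moreover have "card (S \<inter> pverts T'') \<le> k - 1"
    using gen_indep_card_Int_tree_le[OF T(3) ge2.prems(2) G] T(4) by (auto simp: join_by_edge_def)
  moreover have "S = S \<inter> pverts T' \<union> S \<inter> pverts T''"
    using ge2.prems(2) T(4) by (auto simp: gen_indep_def join_by_edge_def)
  then have "card S \<le> card (S \<inter> pverts T') + card (S \<inter> pverts T'')"
    by (metis card_Un_le)
  ultimately show ?case by simp
qed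

section \<open>The generalized independence number of a tree\<close>

theorem theorem1p1:
  fixes T :: "'a pair_pre_digraph" and k n :: nat
  assumes "k \<ge> 2"
    and "graph_tree T" and "card (pverts T) = n" and "n \<ge> k"
  shows "real (gen_indep_number k T) \<ge> (real k - 1) / real k * real n \<and>
    (real (gen_indep_number k T) = (real k - 1) / real k * real n \<longleftrightarrow>
      k dvd n \<and> T \<in> R_family k (n div k))"
proof -
  let ?a = "gen_indep_number k T"
  have fin: "finite (pverts T)"
    using assms(2) by (simp add: graph_tree_def pair_graph_iff)
  have "k \<ge> 1" using assms(1) by simp
  note number_set = gen_indep_number_attained[OF fin this]
  \<comment> \<open>The maximum that defines the number is over a finite nonempty set, hence attained and an upper bound.\<close>
  have attained: "\<exists>S. gen_indep k T S \<and> card S = ?a"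
    using Max_in[OF number_set] unfolding gen_indep_number_def by auto
  have upper: "card S \<le> ?a" if "gen_indep k T S" for S
    unfolding gen_indep_number_def
    by (rule Max_ge[OF number_set(1)]) (use that in auto)
  obtain S where S: "gen_indep k T S" "k * card S > (k - 1) * n \<or>
    k * card S = (k - 1) * n \<and> k dvd n \<and> T \<in> R_family k (n div k)"
    using large_gen_indep_or_R_family[OF assms(2,1)] assms(3) by blast
  have S_le: "k * card S \<le> k * ?a" using upper[OF S(1)] by simp
  have le: "(k - 1) * n \<le> k * ?a" using S(2) S_le by linarith
  have eq: "k * ?a = (k - 1) * n \<longleftrightarrow> k dvd n \<and> T \<in> R_family k (n div k)"
  proof
    assume "k * ?a = (k - 1) * n"
    then show "k dvd n \<and> T \<in> R_family k (n div k)" using S(2) S_le by linarith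
  next
    assume *: "k dvd n \<and> T \<in> R_family k (n div k)"
    then have "?a \<le> n div k * (k - 1)"
      using R_family_gen_indep_card_le attained by metis
    then have "k * ?a \<le> k * (n div k * (k - 1))" by (rule mult_left_mono) simp
    also have "\<dots> = (k - 1) * n" using * by (metis dvd_mult_div_cancel mult.assoc mult.commute)
    finally show "k * ?a = (k - 1) * n" using le by simp
  qed
  have "(real k - 1) / real k * real n \<le> real ?a \<longleftrightarrow> real ((k - 1) * n) \<le> real (k * ?a)"
    and "real ?a = (real k - 1) / real k * real n \<longleftrightarrow> real (k * ?a) = real ((k - 1) * n)"
    using assms(1) by (simp_all add: field_simps of_nat_diff)
  with le eq show ?thesis
    by (simp only: of_nat_le_iff of_nat_eq_iff)
qed

end
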